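(* Let $\mathcal{M}$ be a monoidal category and let $\mathcal{A}$ be a small $\mathcal{M}$-category. Then the Yoneda embedding $Y:\mathcal{A}\to P_{\mathcal{M}}(\mathcal{A})$ is a fully faithful $\mathcal{M}$-functor.
   Context: $\mathcal{M}$ is an arbitrary monoidal category with unit $\mathbf{1}$ (not assumed closed, symmetric, or to have colimits). Associativity and unit constraints are suppressed from the notation. **$\mathcal{M}$-category.** An $\mathcal{M}$-category (= $\mathcal{M}$-enriched category) $\mathcal{A}$ has a set of objects $\mathrm{Ob}(\mathcal{A})$, an object $\hom_{\mathcal{A}}(x,y)\in\mathcal{M}$ for each pair of objects, identity maps $\mathbf{1}\to\hom_{\mathcal{A}}(x,x)$, and associative and unital compositions $\hom_{\mathcal{A}}(y,z)\otimes\hom_{\mathcal{A}}(x,y)\to\hom_{\mathcal{A}}(x,z)$. **Left-tensored category.** A category $\mathcal{B}$ left-tensored over $\mathcal{M}$ is a left (unital, coherently associative) module category over $\mathcal{M}$, with action $\otimes:\mathcal{M}\times\mathcal{B}\to\mathcal{B}$. For $b,b'\in\mathcal{B}$, $\hom_{\mathcal{B}}(b,b')$ denotes the functor $\mathcal{M}^{\mathrm{op}}\to\mathrm{Set}$, $m\mapsto\mathrm{Hom}_{\mathcal{B}}(m\otimes b,b')$. **$\mathcal{M}$-functor from an $\mathcal{M}$-category to a left-tensored category.** An $\mathcal{M}$-functor $f:\mathcal{A}\to\mathcal{B}$ is a map $f:\mathrm{Ob}(\mathcal{A})\to\mathrm{Ob}(\mathcal{B})$ together with morphisms $\hom_{\mathcal{A}}(x,y)\otimes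 f(x)\to f(y)$ in $\mathcal{B}$ for all $x,y$, such that: - for all $x,y,z$ the two maps $\hom_{\mathcal{A}}(y,z)\otimes\hom_{\mathcal{A}}(x,y)\otimes f(x)\to f(z)$ (compose in $\mathcal{A}$ first and then act, or act twice) coincide; - for all $x$ the composite $\mathbf{1}\otimes f(x)\to\hom_{\mathcal{A}}(x,x)\otimes f(x)\to f(x)$ is the unit isomorphism of $\mathcal{B}$. **Fully faithful.** An $\mathcal{M}$-functor $f:\mathcal{A}\to\mathcal{B}$ from an $\mathcal{M}$-category to a left-tensored category is fully faithful if for all $x,y\in\mathrm{Ob}(\mathcal{A})$ the functor $\hom_{\mathcal{B}}(f(x),f(y))$ is represented by $\hom_{\mathcal{A}}(x,y)\in\mathcal{M}$ via the structure map $\hom_{\mathcal{A}}(x,y)\otimes f(x)\to f(y)$; i.e. for every $m\in\mathcal{M}$ the induced map $\mathrm{Hom}_{\mathcal{M}}(m,\hom_{\mathcal{A}}(x,y))\to\mathrm{Hom}_{\mathcal{B}}(m\otimes f(x),f(y))$ is a bijection. **$\mathcal{M}$-presheaves.** An $\mathcal{M}$-presheaf $F$ on $\mathcal{A}$ is a map $F:\mathrm{Ob}(\mathcal{A})\to\mathrm{Ob}(\mathcal{M})$ together with morphisms $F(y)\otimes\hom_{\mathcal{A}}(x,y)\to F(x)$ for all $x,y$, such that for all $x,y,z$ the two maps $F(z)\otimes\hom_{\mathcal{A}}(y,z)\otimes\hom_{\mathcal{A}}(x,y)\to F(x)$ coincide and for all $x$ the composite $F(x)\otimes\mathbf{1}\to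 F(x)\otimes\hom_{\mathcal{A}}(x,x)\to F(x)$ is the unit isomorphism. A morphism $F\to G$ is a collection of morphisms $F(x)\to G(x)$ commuting with the structure maps. The resulting category $P_{\mathcal{M}}(\mathcal{A})$ is left-tensored over $\mathcal{M}$ by $(m\otimes F)(x)=m\otimes F(x)$, with structure maps obtained from those of $F$ by tensoring with $m$ on the left. **Yoneda embedding.** For $z\in\mathrm{Ob}(\mathcal{A})$, $Y(z)\in P_{\mathcal{M}}(\mathcal{A})$ is given by $Y(z)(x)=\hom_{\mathcal{A}}(x,z)$, with structure maps the compositions $\hom_{\mathcal{A}}(y,z)\otimes\hom_{\mathcal{A}}(x,y)\to\hom_{\mathcal{A}}(x,z)$. The $\mathcal{M}$-functor structure $\hom_{\mathcal{A}}(x,y)\otimes Y(x)\to Y(y)$ is given at $z\in\mathrm{Ob}(\mathcal{A})$ by the composition $\hom_{\mathcal{A}}(x,y)\otimes\hom_{\mathcal{A}}(z,x)\to\hom_{\mathcal{A}}(z,y)$. *)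

theory Defs
  imports Main "HOL-Library.FuncSet"
begin

section \<open>Categories\<close>

text \<open>
  Categories are given by carrier sets of objects and arrows; every arrow carries its domain and
  codomain. \<open>g \<cdot> f\<close> is "first \<open>f\<close>, then \<open>g\<close>".
\<close>

record ('o, 'm) category =
  Ob :: "'o set"
  Arr :: "'m set"
  Dom :: "'m \<Rightarrow> 'o"
  Cod :: "'m \<Rightarrow> 'o"
  Id :: "'o \<Rightarrow> 'm"
  cmp :: "'m \<Rightarrow> 'm \<Rightarrow> 'm"  (infixr \<open>\<cdot>\<index>\<close> 55)

definition Hom :: "('o, 'm, 'z) category_scheme \<Rightarrow> 'o \<Rightarrow> 'o \<Rightarrow> 'm set" where
  "Hom C a b = {f \<in> Arr C. Dom C f = a \<and> Cod C f = b}"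

locale category =
  fixes C :: "('o, 'm, 'z) category_scheme" (structure)
  assumes Dom_closed: "f \<in> Arr C \<Longrightarrow> Dom C f \<in> Ob C"
    and Cod_closed: "f \<in> Arr C \<Longrightarrow> Cod C f \<in> Ob C"
    and Id_closed: "a \<in> Ob C \<Longrightarrow> Id C a \<in> Hom C a a"
    and cmp_closed: "\<lbrakk>f \<in> Hom C a b; g \<in> Hom C b c\<rbrakk> \<Longrightarrow> g \<cdot> f \<in> Hom C a c"
    and Id_left: "f \<in> Hom C a b \<Longrightarrow> Id C b \<cdot> f = f"
    and Id_right: "f \<in> Hom C a b \<Longrightarrow> f \<cdot> Id C a = f"
    and cmp_assoc: "\<lbrakk>f \<in> Hom C a b; g \<in> Hom C b c; h \<in> Hom C c d\<rbrakk>
                    \<Longrightarrow> (h \<cdot> g) \<cdot> f = h \<cdot> (g \<cdot> f)"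

definition Iso :: "('o, 'm, 'z) category_scheme \<Rightarrow> 'o \<Rightarrow> 'o \<Rightarrow> 'm set" where
  "Iso C a b = {f \<in> Hom C a b. \<exists>g \<in> Hom C b a. g \<cdot>\<^bsub>C\<^esub> f = Id C a \<and> f \<cdot>\<^bsub>C\<^esub> g = Id C b}"


section \<open>Monoidal categories\<close>

text \<open>
  \<open>\<otimes>\<close> is the tensor product on objects and \<open>\<boxtimes>\<close> the one on arrows. The monoidal category is not
  assumed to be strict, so the constraints appear explicitly.
\<close>

record ('o, 'm) monoidal_category = "('o, 'm) category" +
  tens_ob :: "'o \<Rightarrow> 'o \<Rightarrow> 'o"  (infixr \<open>\<otimes>\<index>\<close> 70)
  tens_arr :: "'m \<Rightarrow> 'm \<Rightarrow> 'm"  (infixr \<open>\<boxtimes>\<index>\<close> 70)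
  tunit :: 'o  (\<open>\<one>\<index>\<close>)
  tassoc :: "'o \<Rightarrow> 'o \<Rightarrow> 'o \<Rightarrow> 'm"
  lunit :: "'o \<Rightarrow> 'm"
  runit :: "'o \<Rightarrow> 'm"

locale monoidal_category = category M
  for M :: "('o, 'm, 'z) monoidal_category_scheme" (structure) +
  assumes tens_ob_closed: "\<lbrakk>a \<in> Ob M; b \<in> Ob M\<rbrakk> \<Longrightarrow> a \<otimes> b \<in> Ob M"
    and tens_arr_closed: "\<lbrakk>f \<in> Hom M a b; g \<in> Hom M c d\<rbrakk> \<Longrightarrow> f \<boxtimes> g \<in> Hom M (a \<otimes> c) (b \<otimes> d)"
    and tens_Id: "\<lbrakk>a \<in> Ob M; b \<in> Ob M\<rbrakk> \<Longrightarrow> Id M a \<boxtimes> Id M b = Id M (a \<otimes> b)"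
    and tens_cmp: "\<lbrakk>f \<in> Hom M a b; f' \<in> Hom M b c; g \<in> Hom M p q; g' \<in> Hom M q r\<rbrakk>
                   \<Longrightarrow> (f' \<cdot> f) \<boxtimes> (g' \<cdot> g) = (f' \<boxtimes> g') \<cdot> (f \<boxtimes> g)"
    and tunit_closed: "\<one> \<in> Ob M"
    and tassoc_iso: "\<lbrakk>a \<in> Ob M; b \<in> Ob M; c \<in> Ob M\<rbrakk>
                     \<Longrightarrow> tassoc M a b c \<in> Iso M ((a \<otimes> b) \<otimes> c) (a \<otimes> (b \<otimes> c))"
    and tassoc_natural: "\<lbrakk>f \<in> Hom M a a'; g \<in> Hom M b b'; h \<in> Hom M c c'\<rbrakk>
                         \<Longrightarrow> tassoc M a' b' c' \<cdot> ((f \<boxtimes> g) \<boxtimes> h) = (f \<boxtimes> (g \<boxtimes> h)) \<cdot> tassoc M a b c"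
    and lunit_iso: "a \<in> Ob M \<Longrightarrow> lunit M a \<in> Iso M (\<one> \<otimes> a) a"
    and lunit_natural: "f \<in> Hom M a b \<Longrightarrow> lunit M b \<cdot> (Id M \<one> \<boxtimes> f) = f \<cdot> lunit M a"
    and runit_iso: "a \<in> Ob M \<Longrightarrow> runit M a \<in> Iso M (a \<otimes> \<one>) a"
    and runit_natural: "f \<in> Hom M a b \<Longrightarrow> runit M b \<cdot> (f \<boxtimes> Id M \<one>) = f \<cdot> runit M a"
    and pentagon: "\<lbrakk>a \<in> Ob M; b \<in> Ob M; c \<in> Ob M; d \<in> Ob M\<rbrakk> \<Longrightarrow>
          tassoc M a b (c \<otimes> d) \<cdot> tassoc M (a \<otimes> b) c d
        = (Id M a \<boxtimes> tassoc M b c d) \<cdot> tassoc M a (b \<otimes> c) d \<cdot> (tassoc M a b c \<boxtimes> Id M d)"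
    and triangle: "\<lbrakk>a \<in> Ob M; b \<in> Ob M\<rbrakk> \<Longrightarrow>
          (Id M a \<boxtimes> lunit M b) \<cdot> tassoc M a \<one> b = runit M a \<boxtimes> Id M b"


section \<open>Left-tensored categories\<close>

text \<open>
  \<open>\<odot>\<close> is the action of objects of \<open>M\<close> on objects of \<open>B\<close>, and \<open>\<boxdot>\<close> the action of arrows on arrows.
\<close>

record ('b, 'n, 'o, 'm) left_tensored = "('b, 'n) category" +
  act_ob :: "'o \<Rightarrow> 'b \<Rightarrow> 'b"  (infixr \<open>\<odot>\<index>\<close> 70)
  act_arr :: "'m \<Rightarrow> 'n \<Rightarrow> 'n"  (infixr \<open>\<boxdot>\<index>\<close> 70)
  act_assoc :: "'o \<Rightarrow> 'o \<Rightarrow> 'b \<Rightarrow> 'n"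
  act_unit :: "'b \<Rightarrow> 'n"

locale left_tensored_category = monoidal_category M + B: category B
  for M :: "('o, 'm, 'z) monoidal_category_scheme" (structure)
    and B :: "('b, 'n, 'o, 'm, 'y) left_tensored_scheme" +
  assumes act_ob_closed: "\<lbrakk>m \<in> Ob M; b \<in> Ob B\<rbrakk> \<Longrightarrow> m \<odot>\<^bsub>B\<^esub> b \<in> Ob B"
    and act_arr_closed: "\<lbrakk>g \<in> Hom M m m'; f \<in> Hom B b b'\<rbrakk>
                         \<Longrightarrow> g \<boxdot>\<^bsub>B\<^esub> f \<in> Hom B (m \<odot>\<^bsub>B\<^esub> b) (m' \<odot>\<^bsub>B\<^esub> b')"
    and act_Id: "\<lbrakk>m \<in> Ob M; b \<in> Ob B\<rbrakk> \<Longrightarrow> Id M m \<boxdot>\<^bsub>B\<^esub> Id B b = Id B (m \<odot>\<^bsub>B\<^esub> b)"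
    and act_cmp: "\<lbrakk>g \<in> Hom M m m'; g' \<in> Hom M m' m''; f \<in> Hom B b b'; f' \<in> Hom B b' b''\<rbrakk>
                  \<Longrightarrow> (g' \<cdot> g) \<boxdot>\<^bsub>B\<^esub> (f' \<cdot>\<^bsub>B\<^esub> f) = (g' \<boxdot>\<^bsub>B\<^esub> f') \<cdot>\<^bsub>B\<^esub> (g \<boxdot>\<^bsub>B\<^esub> f)"
    and act_assoc_iso: "\<lbrakk>m \<in> Ob M; n \<in> Ob M; b \<in> Ob B\<rbrakk>
                        \<Longrightarrow> act_assoc B m n b \<in> Iso B ((m \<otimes> n) \<odot>\<^bsub>B\<^esub> b) (m \<odot>\<^bsub>B\<^esub> (n \<odot>\<^bsub>B\<^esub> b))"
    and act_assoc_natural: "\<lbrakk>g \<in> Hom M m m'; h \<in> Hom M n n'; f \<in> Hom B b b'\<rbrakk> \<Longrightarrow>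
          act_assoc B m' n' b' \<cdot>\<^bsub>B\<^esub> ((g \<boxtimes> h) \<boxdot>\<^bsub>B\<^esub> f) = (g \<boxdot>\<^bsub>B\<^esub> (h \<boxdot>\<^bsub>B\<^esub> f)) \<cdot>\<^bsub>B\<^esub> act_assoc B m n b"
    and act_unit_iso: "b \<in> Ob B \<Longrightarrow> act_unit B b \<in> Iso B (\<one> \<odot>\<^bsub>B\<^esub> b) b"
    and act_unit_natural: "f \<in> Hom B b b' \<Longrightarrow>
          act_unit B b' \<cdot>\<^bsub>B\<^esub> (Id M \<one> \<boxdot>\<^bsub>B\<^esub> f) = f \<cdot>\<^bsub>B\<^esub> act_unit B b"
    and act_pentagon: "\<lbrakk>k \<in> Ob M; m \<in> Ob M; n \<in> Ob M; b \<in> Ob B\<rbrakk> \<Longrightarrow>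
          act_assoc B k m (n \<odot>\<^bsub>B\<^esub> b) \<cdot>\<^bsub>B\<^esub> act_assoc B (k \<otimes> m) n b
        = (Id M k \<boxdot>\<^bsub>B\<^esub> act_assoc B m n b) \<cdot>\<^bsub>B\<^esub> act_assoc B k (m \<otimes> n) b
            \<cdot>\<^bsub>B\<^esub> (tassoc M k m n \<boxdot>\<^bsub>B\<^esub> Id B b)"
    and act_triangle: "\<lbrakk>m \<in> Ob M; b \<in> Ob B\<rbrakk> \<Longrightarrow>
          (Id M m \<boxdot>\<^bsub>B\<^esub> act_unit B b) \<cdot>\<^bsub>B\<^esub> act_assoc B m \<one> b = runit M m \<boxdot>\<^bsub>B\<^esub> Id B b"


section \<open>Enriched categories\<close>

text \<open>
  \<open>ecmp A x y z\<close> is the composition \<open>hom(y,z) \<otimes> hom(x,y) \<rightarrow> hom(x,z)\<close>. Smallness needs no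
  separate hypothesis, since the objects form a set.
\<close>

record ('a, 'o, 'm) enriched_category =
  EOb :: "'a set"
  hom :: "'a \<Rightarrow> 'a \<Rightarrow> 'o"
  eid :: "'a \<Rightarrow> 'm"
  ecmp :: "'a \<Rightarrow> 'a \<Rightarrow> 'a \<Rightarrow> 'm"

locale enriched_category = monoidal_category M
  for M :: "('o, 'm, 'z) monoidal_category_scheme" (structure)
    and A :: "('a, 'o, 'm, 'y) enriched_category_scheme" +
  assumes hom_closed: "\<lbrakk>x \<in> EOb A; y \<in> EOb A\<rbrakk> \<Longrightarrow> hom A x y \<in> Ob M"
    and eid_closed: "x \<in> EOb A \<Longrightarrow> eid A x \<in> Hom M \<one> (hom A x x)"
    and ecmp_closed: "\<lbrakk>x \<in> EOb A; y \<in> EOb A; z \<in> EOb A\<rbrakk>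
                      \<Longrightarrow> ecmp A x y z \<in> Hom M (hom A y z \<otimes> hom A x y) (hom A x z)"
    and ecmp_assoc: "\<lbrakk>w \<in> EOb A; x \<in> EOb A; y \<in> EOb A; z \<in> EOb A\<rbrakk> \<Longrightarrow>
          ecmp A w x z \<cdot> (ecmp A x y z \<boxtimes> Id M (hom A w x))
        = ecmp A w y z \<cdot> (Id M (hom A y z) \<boxtimes> ecmp A w x y)
            \<cdot> tassoc M (hom A y z) (hom A x y) (hom A w x)"
    and ecmp_eid_left: "\<lbrakk>x \<in> EOb A; y \<in> EOb A\<rbrakk> \<Longrightarrow>
          ecmp A x y y \<cdot> (eid A y \<boxtimes> Id M (hom A x y)) = lunit M (hom A x y)"
    and ecmp_eid_right: "\<lbrakk>x \<in> EOb A; y \<in> EOb A\<rbrakk> \<Longrightarrow>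
          ecmp A x x y \<cdot> (Id M (hom A x y) \<boxtimes> eid A x) = runit M (hom A x y)"


section \<open>Enriched functors into left-tensored categories\<close>

text \<open>\<open>fstr f x y\<close> is the structure map \<open>hom(x,y) \<odot> f(x) \<rightarrow> f(y)\<close>.\<close>

record ('a, 'b, 'n) enriched_functor =
  fob :: "'a \<Rightarrow> 'b"
  fstr :: "'a \<Rightarrow> 'a \<Rightarrow> 'n"

locale enriched_functor = enriched_category M A + left_tensored_category M B
  for M :: "('o, 'm, 'z) monoidal_category_scheme" (structure)
    and A :: "('a, 'o, 'm, 'y) enriched_category_scheme"
    and B :: "('b, 'n, 'o, 'm, 'x) left_tensored_scheme"
    and f :: "('a, 'b, 'n, 'w) enriched_functor_scheme" +
  assumes fob_closed: "x \<in> EOb A \<Longrightarrow> fob f x \<in> Ob B"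
    and fstr_closed: "\<lbrakk>x \<in> EOb A; y \<in> EOb A\<rbrakk>
                      \<Longrightarrow> fstr f x y \<in> Hom B (hom A x y \<odot>\<^bsub>B\<^esub> fob f x) (fob f y)"
    and fstr_ecmp: "\<lbrakk>x \<in> EOb A; y \<in> EOb A; z \<in> EOb A\<rbrakk> \<Longrightarrow>
          fstr f x z \<cdot>\<^bsub>B\<^esub> (ecmp A x y z \<boxdot>\<^bsub>B\<^esub> Id B (fob f x))
        = fstr f y z \<cdot>\<^bsub>B\<^esub> (Id M (hom A y z) \<boxdot>\<^bsub>B\<^esub> fstr f x y)
            \<cdot>\<^bsub>B\<^esub> act_assoc B (hom A y z) (hom A x y) (fob f x)"
    and fstr_eid: "x \<in> EOb A \<Longrightarrow>
          fstr f x x \<cdot>\<^bsub>B\<^esub> (eid A x \<boxdot>\<^bsub>B\<^esub> Id B (fob f x)) = act_unit B (fob f x)"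

locale fully_faithful_functor = enriched_functor +
  assumes represents: "\<lbrakk>x \<in> EOb A; y \<in> EOb A; m \<in> Ob M\<rbrakk> \<Longrightarrow>
    bij_betw (\<lambda>g. fstr f x y \<cdot>\<^bsub>B\<^esub> (g \<boxdot>\<^bsub>B\<^esub> Id B (fob f x)))
      (Hom M m (hom A x y)) (Hom B (m \<odot>\<^bsub>B\<^esub> fob f x) (fob f y))"


section \<open>Presheaves\<close>

text \<open>
  \<open>pstr F x y\<close> is the structure map \<open>F(y) \<otimes> hom(x,y) \<rightarrow> F(x)\<close>. All families are required to be
  extensional (\<open>undefined\<close> off the objects of \<open>A\<close>), so that equality in HOL of presheaves and of
  their morphisms is the intended equality.
\<close>

record ('a, 'o, 'm) presheaf =
  pob :: "'a \<Rightarrow> 'o"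
  pstr :: "'a \<Rightarrow> 'a \<Rightarrow> 'm"

locale presheaf = enriched_category M A
  for M :: "('o, 'm, 'z) monoidal_category_scheme" (structure)
    and A :: "('a, 'o, 'm, 'y) enriched_category_scheme"
    and F :: "('a, 'o, 'm) presheaf" +
  assumes pob_closed: "pob F \<in> EOb A \<rightarrow>\<^sub>E Ob M"
    and pstr_closed: "pstr F \<in> (\<Pi>\<^sub>E x \<in> EOb A. \<Pi>\<^sub>E y \<in> EOb A. Hom M (pob F y \<otimes> hom A x y) (pob F x))"
    and pstr_ecmp: "\<lbrakk>x \<in> EOb A; y \<in> EOb A; z \<in> EOb A\<rbrakk> \<Longrightarrow>
          pstr F x y \<cdot> (pstr F y z \<boxtimes> Id M (hom A x y))
        = pstr F x z \<cdot> (Id M (pob F z) \<boxtimes> ecmp A x y z)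
            \<cdot> tassoc M (pob F z) (hom A y z) (hom A x y)"
    and pstr_eid: "x \<in> EOb A \<Longrightarrow>
          pstr F x x \<cdot> (Id M (pob F x) \<boxtimes> eid A x) = runit M (pob F x)"

record ('a, 'o, 'm) presheaf_map =
  psrc :: "('a, 'o, 'm) presheaf"
  ptgt :: "('a, 'o, 'm) presheaf"
  pcomp :: "'a \<Rightarrow> 'm"

locale presheaf_map = src: presheaf M A "psrc \<phi>" + tgt: presheaf M A "ptgt \<phi>"
  for M :: "('o, 'm, 'z) monoidal_category_scheme" (structure)
    and A :: "('a, 'o, 'm, 'y) enriched_category_scheme"
    and \<phi> :: "('a, 'o, 'm) presheaf_map" +
  assumes pcomp_closed: "pcomp \<phi> \<in> (\<Pi>\<^sub>E x \<in> EOb A. Hom M (pob (psrc \<phi>) x) (pob (ptgt \<phi>) x))"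
    and pcomp_natural: "\<lbrakk>x \<in> EOb A; y \<in> EOb A\<rbrakk> \<Longrightarrow>
          pstr (ptgt \<phi>) x y \<cdot> (pcomp \<phi> y \<boxtimes> Id M (hom A x y)) = pcomp \<phi> x \<cdot> pstr (psrc \<phi>) x y"

definition presheaf_act ::
  "('o, 'm, 'z) monoidal_category_scheme \<Rightarrow> ('a, 'o, 'm, 'y) enriched_category_scheme
    \<Rightarrow> 'o \<Rightarrow> ('a, 'o, 'm) presheaf \<Rightarrow> ('a, 'o, 'm) presheaf" where
  "presheaf_act M A m F =
    \<lparr> pob = (\<lambda>x \<in> EOb A. m \<otimes>\<^bsub>M\<^esub> pob F x),
      pstr = (\<lambda>x \<in> EOb A. \<lambda>y \<in> EOb A.
        (Id M m \<boxtimes>\<^bsub>M\<^esub> pstr F x y) \<cdot>\<^bsub>M\<^esub> tassoc M m (pob F y) (hom A x y)) \<rparr>"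

definition presheaves ::
  "('o, 'm, 'z) monoidal_category_scheme \<Rightarrow> ('a, 'o, 'm, 'y) enriched_category_scheme
    \<Rightarrow> (('a, 'o, 'm) presheaf, ('a, 'o, 'm) presheaf_map, 'o, 'm) left_tensored" where
  "presheaves M A =
    \<lparr> Ob = {F. presheaf M A F},
      Arr = {\<phi>. presheaf_map M A \<phi>},
      Dom = psrc,
      Cod = ptgt,
      Id = (\<lambda>F. \<lparr> psrc = F, ptgt = F, pcomp = (\<lambda>x \<in> EOb A. Id M (pob F x)) \<rparr>),
      cmp = (\<lambda>\<psi> \<phi>. \<lparr> psrc = psrc \<phi>, ptgt = ptgt \<psi>,
        pcomp = (\<lambda>x \<in> EOb A. pcomp \<psi> x \<cdot>\<^bsub>M\<^esub> pcomp \<phi> x) \<rparr>),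
      act_ob = presheaf_act M A,
      act_arr = (\<lambda>g \<phi>. \<lparr> psrc = presheaf_act M A (Dom M g) (psrc \<phi>),
        ptgt = presheaf_act M A (Cod M g) (ptgt \<phi>),
        pcomp = (\<lambda>x \<in> EOb A. g \<boxtimes>\<^bsub>M\<^esub> pcomp \<phi> x) \<rparr>),
      act_assoc = (\<lambda>m n F. \<lparr> psrc = presheaf_act M A (m \<otimes>\<^bsub>M\<^esub> n) F,
        ptgt = presheaf_act M A m (presheaf_act M A n F),
        pcomp = (\<lambda>x \<in> EOb A. tassoc M m n (pob F x)) \<rparr>),
      act_unit = (\<lambda>F. \<lparr> psrc = presheaf_act M A \<one>\<^bsub>M\<^esub> F, ptgt = F,
        pcomp = (\<lambda>x \<in> EOb A. lunit M (pob F x)) \<rparr>) \<rparr>"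


section \<open>The Yoneda embedding\<close>

definition yoneda_ob ::
  "('a, 'o, 'm, 'y) enriched_category_scheme \<Rightarrow> 'a \<Rightarrow> ('a, 'o, 'm) presheaf" where
  "yoneda_ob A z =
    \<lparr> pob = (\<lambda>x \<in> EOb A. hom A x z),
      pstr = (\<lambda>x \<in> EOb A. \<lambda>y \<in> EOb A. ecmp A x y z) \<rparr>"

definition yoneda ::
  "('o, 'm, 'z) monoidal_category_scheme \<Rightarrow> ('a, 'o, 'm, 'y) enriched_category_scheme
    \<Rightarrow> ('a, ('a, 'o, 'm) presheaf, ('a, 'o, 'm) presheaf_map) enriched_functor" where
  "yoneda M A =
    \<lparr> fob = yoneda_ob A,
      fstr = (\<lambda>x y. \<lparr> psrc = presheaf_act M A (hom A x y) (yoneda_ob A x),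
        ptgt = yoneda_ob A y,
        pcomp = (\<lambda>z \<in> EOb A. ecmp A z x y) \<rparr>) \<rparr>"

end

theory Submission
  imports Defs
begin

text \<open>
  A morphism \<open>\<phi> : m \<otimes> Y(x) \<rightarrow> Y(y)\<close> corresponds to the arrow
  \<open>m \<cong> m \<otimes> \<one> \<rightarrow> m \<otimes> hom(x,x) \<rightarrow> hom(x,y)\<close> obtained by evaluating \<open>\<phi>\<close> at the identity of \<open>x\<close>; naturality
  of \<open>\<phi>\<close> and the triangle axiom recover \<open>\<phi>\<close> from it. That presheaves are left-tensored rests on
  Kelly's two additional coherence laws for the units: the one for \<open>\<lambda>\<close> makes \<open>\<one> \<otimes> F \<rightarrow> F\<close> a
  morphism of presheaves, and the one for \<open>\<rho>\<close> is the unit axiom of \<open>m \<otimes> F\<close>.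
\<close>

section \<open>Calculating with typed arrows\<close>

text \<open>Splitting \<open>Hom\<close> into \<open>Arr\<close>, \<open>Dom\<close> and
  \<open>Cod\<close> turns every typing side condition into equations that simplification can
  discharge; the rules below are restated in this form.\<close>

lemma Hom_iff: "f \<in> Hom C a b \<longleftrightarrow> f \<in> Arr C \<and> Dom C f = a \<and> Cod C f = b"
  by (auto simp: Hom_def)

lemma Iso_iff: "f \<in> Iso C a b \<longleftrightarrow>
    f \<in> Hom C a b \<and> (\<exists>g \<in> Hom C b a. g \<cdot>\<^bsub>C\<^esub> f = Id C a \<and> f \<cdot>\<^bsub>C\<^esub> g = Id C b)"
  by (auto simp: Iso_def)

context category
begin

lemma Dom_Ob [simp]: "f \<in> Arr C \<Longrightarrow> Dom C f \<in> Ob C"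
  and Cod_Ob [simp]: "f \<in> Arr C \<Longrightarrow> Cod C f \<in> Ob C"
  by (rule Dom_closed, assumption) (rule Cod_closed)

lemma Id_simps [simp]:
  assumes "a \<in> Ob C"
  shows "Id C a \<in> Arr C" "Dom C (Id C a) = a" "Cod C (Id C a) = a"
  using Id_closed [OF assms] by (auto simp: Hom_iff)

lemma cmp_simps [simp]:
  assumes "f \<in> Arr C" "g \<in> Arr C" "Dom C g = Cod C f"
  shows "g \<cdot> f \<in> Arr C" "Dom C (g \<cdot> f) = Dom C f" "Cod C (g \<cdot> f) = Cod C g"
  using cmp_closed [of f "Dom C f" "Cod C f" g "Cod C g"] assms by (auto simp: Hom_iff)

lemma Id_cmp [simp]: "\<lbrakk>f \<in> Arr C; Cod C f = b\<rbrakk> \<Longrightarrow> Id C b \<cdot> f = f"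
  and cmp_Id [simp]: "\<lbrakk>f \<in> Arr C; Dom C f = a\<rbrakk> \<Longrightarrow> f \<cdot> Id C a = f"
  by (auto intro: Id_left Id_right simp: Hom_iff)

text \<open>Kept out of the simp set because both directions are needed: left to right to normalise
  brackets, reversed to expose a pair of factors at the front.\<close>

lemma cmp_assoc_Arr:
  "\<lbrakk>f \<in> Arr C; g \<in> Arr C; h \<in> Arr C; Dom C g = Cod C f; Dom C h = Cod C g\<rbrakk>
    \<Longrightarrow> (h \<cdot> g) \<cdot> f = h \<cdot> (g \<cdot> f)"
  by (rule cmp_assoc) (auto simp: Hom_iff)

lemma Iso_simps:
  assumes "e \<in> Iso C a b"
  shows "e \<in> Arr C" "Dom C e = a" "Cod C e = b"
  using assms by (auto simp: Iso_iff Hom_iff)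

text \<open>Composing with an inverse shows that isomorphisms are monic and, in the companion rule,
  epic. This is how invertible constraints are stripped off below.\<close>

lemma Iso_cancel_left:
  assumes "e \<in> Iso C a b" and "f \<in> Hom C c a" "g \<in> Hom C c a" and eq: "e \<cdot> f = e \<cdot> g"
  shows "f = g"
proof -
  obtain e' where e': "e' \<in> Hom C b a" "e' \<cdot> e = Id C a" and e: "e \<in> Hom C a b"
    using assms(1) by (auto simp: Iso_iff)
  have "f = e' \<cdot> (e \<cdot> f)"
    using cmp_assoc [OF assms(2) e e'(1)] Id_left [OF assms(2)] e'(2) by simp
  also have "\<dots> = g"
    using cmp_assoc [OF assms(3) e e'(1)] Id_left [OF assms(3)] e'(2) eq by simp
  finally show ?thesis .
qed

lemma Iso_cancel_right:
  assumes "e \<in> Iso C a b" and "f \<in> Hom C b c" "g \<in> Hom C b c" and eq: "f \<cdot> e = g \<cdot> e"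
  shows "f = g"
proof -
  obtain e' where e': "e' \<in> Hom C b a" "e \<cdot> e' = Id C b" and e: "e \<in> Hom C a b"
    using assms(1) by (auto simp: Iso_iff)
  have "f = (f \<cdot> e) \<cdot> e'"
    using cmp_assoc [OF e'(1) e assms(2)] Id_right [OF assms(2)] e'(2) by simp
  also have "\<dots> = g"
    using cmp_assoc [OF e'(1) e assms(3)] Id_right [OF assms(3)] e'(2) eq by simp
  finally show ?thesis .
qed

end

section \<open>Coherence of the unit constraints\<close>

context monoidal_category
begin

section \<open>Typing and rewriting rules for the tensor product\<close>

declare tens_ob_closed [simp] tunit_closed [simp] tens_Id [simp]

lemma tens_arr_simps [simp]:
  assumes "f \<in> Arr M" "g \<in> Arr M"
  shows "f \<boxtimes> g \<in> Arr M"
    "Dom M (f \<boxtimes> g) = Dom M f \<otimes> Dom M g" "Cod M (f \<boxtimes> g) = Cod M f \<otimes> Cod M g"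
  using tens_arr_closed [of f "Dom M f" "Cod M f" g "Dom M g" "Cod M g"] assms
  by (auto simp: Hom_iff)

lemma tassoc_simps [simp]:
  assumes "a \<in> Ob M" "b \<in> Ob M" "c \<in> Ob M"
  shows "tassoc M a b c \<in> Arr M"
    "Dom M (tassoc M a b c) = (a \<otimes> b) \<otimes> c" "Cod M (tassoc M a b c) = a \<otimes> b \<otimes> c"
  using tassoc_iso [OF assms] by (auto dest: Iso_simps)

lemma lunit_simps [simp]:
  assumes "a \<in> Ob M"
  shows "lunit M a \<in> Arr M" "Dom M (lunit M a) = \<one> \<otimes> a" "Cod M (lunit M a) = a"
  using lunit_iso [OF assms] by (auto dest: Iso_simps)

lemma runit_simps [simp]:
  assumes "a \<in> Ob M"
  shows "runit M a \<in> Arr M" "Dom M (runit M a) = a \<otimes> \<one>" "Cod M (runit M a) = a"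
  using runit_iso [OF assms] by (auto dest: Iso_simps)

lemma tens_cmp_Arr:
  "\<lbrakk>f \<in> Arr M; f' \<in> Arr M; g \<in> Arr M; g' \<in> Arr M; Dom M f' = Cod M f; Dom M g' = Cod M g\<rbrakk>
    \<Longrightarrow> (f' \<boxtimes> g') \<cdot> (f \<boxtimes> g) = (f' \<cdot> f) \<boxtimes> (g' \<cdot> g)"
  by (rule tens_cmp [symmetric]) (auto simp: Hom_iff)

text \<open>The interchange law with a trailing factor \<open>k\<close>: in a composite bracketed to
  the right, two adjacent tensors do not form a subterm of their own.\<close>

lemma tens_cmp_cmp_Arr:
  "\<lbrakk>f \<in> Arr M; f' \<in> Arr M; g \<in> Arr M; g' \<in> Arr M; Dom M f' = Cod M f; Dom M g' = Cod M g;
    k \<in> Arr M; Cod M k = Dom M f \<otimes> Dom M g\<rbrakk>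
    \<Longrightarrow> (f' \<boxtimes> g') \<cdot> ((f \<boxtimes> g) \<cdot> k) = ((f' \<cdot> f) \<boxtimes> (g' \<cdot> g)) \<cdot> k"
  by (simp add: cmp_assoc_Arr [symmetric] tens_cmp_Arr)

text \<open>The indices of the associator are tied to the codomains by equations, so the rule still
  matches once those codomains have been simplified to named objects.\<close>

lemma tassoc_natural_Arr:
  "\<lbrakk>f \<in> Arr M; g \<in> Arr M; h \<in> Arr M; a = Cod M f; b = Cod M g; c = Cod M h\<rbrakk> \<Longrightarrow>
    tassoc M a b c \<cdot> ((f \<boxtimes> g) \<boxtimes> h)
      = (f \<boxtimes> (g \<boxtimes> h)) \<cdot> tassoc M (Dom M f) (Dom M g) (Dom M h)"
  by (rule tassoc_natural) (auto simp: Hom_iff)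

lemma lunit_natural_Arr:
  "\<lbrakk>f \<in> Arr M; b = Cod M f\<rbrakk> \<Longrightarrow> lunit M b \<cdot> (Id M \<one> \<boxtimes> f) = f \<cdot> lunit M (Dom M f)"
  by (rule lunit_natural) (auto simp: Hom_iff)

text \<open>Naturality of \<open>lunit\<close> expresses \<open>f \<cdot> lunit M a\<close> through
  \<open>Id M \<one> \<boxtimes> f\<close>, and the invertible \<open>lunit M a\<close>
  cancels.\<close>

lemma tens_unit_left_faithful:
  assumes f: "f \<in> Hom M a b" and g: "g \<in> Hom M a b" and eq: "Id M \<one> \<boxtimes> f = Id M \<one> \<boxtimes> g"
  shows "f = g"
proof (rule Iso_cancel_right [OF lunit_iso f g])
  show "a \<in> Ob M" using f by (auto simp: Hom_iff)
  show "f \<cdot> lunit M a = g \<cdot> lunit M a"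
    using lunit_natural [OF f] lunit_natural [OF g] eq by simp
qed

lemma tens_unit_right_faithful:
  assumes f: "f \<in> Hom M a b" and g: "g \<in> Hom M a b" and eq: "f \<boxtimes> Id M \<one> = g \<boxtimes> Id M \<one>"
  shows "f = g"
proof (rule Iso_cancel_right [OF runit_iso f g])
  show "a \<in> Ob M" using f by (auto simp: Hom_iff)
  show "f \<cdot> runit M a = g \<cdot> runit M a"
    using runit_natural [OF f] runit_natural [OF g] eq by simp
qed

text \<open>By interchange, the tensor of two inverses is an inverse of the tensor.\<close>

lemma tens_iso:
  assumes e: "e \<in> Iso M a b" and f: "f \<in> Iso M c d"
  shows "e \<boxtimes> f \<in> Iso M (a \<otimes> c) (b \<otimes> d)"
proof -
  obtain e' f' where "e' \<in> Hom M b a" "e' \<cdot> e = Id M a" "e \<cdot> e' = Id M b"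
    "f' \<in> Hom M d c" "f' \<cdot> f = Id M c" "f \<cdot> f' = Id M d"
    using e f by (auto simp: Iso_iff)
  then show ?thesis
    using Iso_simps [OF e] Iso_simps [OF f]
    unfolding Iso_iff Hom_iff
    by (intro conjI bexI [of _ "e' \<boxtimes> f'"]) (auto simp: Hom_iff tens_cmp_Arr)
qed

lemma Id_iso: "a \<in> Ob M \<Longrightarrow> Id M a \<in> Iso M a a"
  by (auto simp: Iso_iff Hom_iff intro!: bexI [of _ "Id M a"])

text \<open>
  Kelly's argument: tensoring with the unit is faithful, and after tensoring the claim
  follows from the pentagon and two instances of the triangle.
\<close>

lemma lunit_tens:
  assumes a [simp]: "a \<in> Ob M" and b [simp]: "b \<in> Ob M"
  shows "lunit M (a \<otimes> b) \<cdot> tassoc M \<one> a b = lunit M a \<boxtimes> Id M b"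
proof (rule tens_unit_left_faithful)
  \<comment> \<open>The last two factors on the long side of the pentagon at \<open>\<one>\<close>,
    \<open>\<one>\<close>, \<open>a\<close>, \<open>b\<close>. They are invertible, so it suffices
    to compare both sides after composing with them.\<close>
  let ?p = "tassoc M \<one> (\<one> \<otimes> a) b \<cdot> (tassoc M \<one> \<one> a \<boxtimes> Id M b)"
  have "(Id M \<one> \<boxtimes> (lunit M (a \<otimes> b) \<cdot> tassoc M \<one> a b)) \<cdot> ?p
      = (Id M \<one> \<boxtimes> lunit M (a \<otimes> b)) \<cdot> ((Id M \<one> \<boxtimes> tassoc M \<one> a b) \<cdot> ?p)"
    by (simp add: tens_cmp_cmp_Arr)
  also have "\<dots> = (Id M \<one> \<boxtimes> lunit M (a \<otimes> b)) \<cdot> (tassoc M \<one> \<one> (a \<otimes> b) \<cdot> tassoc M (\<one> \<otimes> \<one>) a b)"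
    by (simp add: pentagon)
  \<comment> \<open>Triangle at \<open>\<one>\<close> and \<open>a \<otimes> b\<close>; the identity
    of \<open>a \<otimes> b\<close> is written as a tensor to prepare for naturality of the
    associator.\<close>
  also have "\<dots> = (runit M \<one> \<boxtimes> (Id M a \<boxtimes> Id M b)) \<cdot> tassoc M (\<one> \<otimes> \<one>) a b"
    by (simp add: cmp_assoc_Arr [symmetric] triangle)
  also have "\<dots> = tassoc M \<one> a b \<cdot> ((runit M \<one> \<boxtimes> Id M a) \<boxtimes> Id M b)"
    by (subst tassoc_natural_Arr) simp_all
  \<comment> \<open>Triangle at \<open>\<one>\<close> and \<open>a\<close>, read backwards and
    tensored with \<open>b\<close>.\<close>
  also have "\<dots> = tassoc M \<one> a b \<cdot> (((Id M \<one> \<boxtimes> lunit M a) \<boxtimes> Id M b) \<cdot> (tassoc M \<one> \<one> a \<boxtimes> Id M b))"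
    by (simp add: triangle tens_cmp_Arr)
  also have "\<dots> = (Id M \<one> \<boxtimes> (lunit M a \<boxtimes> Id M b)) \<cdot> ?p"
    by (simp add: cmp_assoc_Arr [symmetric] tassoc_natural_Arr)
  finally have *: "(Id M \<one> \<boxtimes> (lunit M (a \<otimes> b) \<cdot> tassoc M \<one> a b)) \<cdot> ?p = \<dots>" .
  have i: "tassoc M \<one> \<one> a \<boxtimes> Id M b \<in> Iso M (((\<one> \<otimes> \<one>) \<otimes> a) \<otimes> b) ((\<one> \<otimes> (\<one> \<otimes> a)) \<otimes> b)"
    by (intro tens_iso tassoc_iso Id_iso) simp_all
  have j: "tassoc M \<one> (\<one> \<otimes> a) b \<in> Iso M ((\<one> \<otimes> (\<one> \<otimes> a)) \<otimes> b) (\<one> \<otimes> ((\<one> \<otimes> a) \<otimes> b))"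
    by (intro tassoc_iso) simp_all
  show "Id M \<one> \<boxtimes> (lunit M (a \<otimes> b) \<cdot> tassoc M \<one> a b) = Id M \<one> \<boxtimes> (lunit M a \<boxtimes> Id M b)"
    \<comment> \<open>The composite \<open>?p\<close> is cancelled one factor at a time.\<close>
    by (rule Iso_cancel_right [OF j], rule_tac [3] Iso_cancel_right [OF i])
      (use * in \<open>simp_all add: Hom_iff cmp_assoc_Arr\<close>)
qed (simp_all add: Hom_iff)

text \<open>Mirror image of \<open>lunit_tens\<close>: tensoring with the unit on the right is
  faithful, and the claim follows from the pentagon at \<open>a\<close>, \<open>b\<close>,
  \<open>\<one>\<close>, \<open>\<one>\<close> with the triangles at \<open>b\<close> and at
  \<open>a \<otimes> b\<close>. The extra \<open>tassoc M a b \<one>\<close> in front is invertible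
  and cancels at the end.\<close>

lemma runit_tens:
  assumes a [simp]: "a \<in> Ob M" and b [simp]: "b \<in> Ob M"
  shows "(Id M a \<boxtimes> runit M b) \<cdot> tassoc M a b \<one> = runit M (a \<otimes> b)"
proof (rule tens_unit_right_faithful)
  let ?p = "tassoc M a (b \<otimes> \<one>) \<one> \<cdot> (tassoc M a b \<one> \<boxtimes> Id M \<one>)"
  have "tassoc M a b \<one> \<cdot> (((Id M a \<boxtimes> runit M b) \<cdot> tassoc M a b \<one>) \<boxtimes> Id M \<one>)
      = tassoc M a b \<one> \<cdot> (((Id M a \<boxtimes> runit M b) \<boxtimes> Id M \<one>) \<cdot> (tassoc M a b \<one> \<boxtimes> Id M \<one>))"
    by (simp add: tens_cmp_Arr)
  also have "\<dots> = (Id M a \<boxtimes> (runit M b \<boxtimes> Id M \<one>)) \<cdot> ?p"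
    by (simp add: cmp_assoc_Arr [symmetric] tassoc_natural_Arr)
  also have "\<dots> = (Id M a \<boxtimes> (Id M b \<boxtimes> lunit M \<one>)) \<cdot> ((Id M a \<boxtimes> tassoc M b \<one> \<one>) \<cdot> ?p)"
    by (simp add: tens_cmp_cmp_Arr triangle)
  also have "\<dots> = (Id M a \<boxtimes> (Id M b \<boxtimes> lunit M \<one>))
      \<cdot> (tassoc M a b (\<one> \<otimes> \<one>) \<cdot> tassoc M (a \<otimes> b) \<one> \<one>)"
    by (simp add: pentagon)
  also have "\<dots> = (tassoc M a b \<one> \<cdot> ((Id M a \<boxtimes> Id M b) \<boxtimes> lunit M \<one>)) \<cdot> tassoc M (a \<otimes> b) \<one> \<one>"
    by (subst tassoc_natural_Arr) (simp_all add: cmp_assoc_Arr)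
  also have "\<dots> = tassoc M a b \<one> \<cdot> (runit M (a \<otimes> b) \<boxtimes> Id M \<one>)"
    by (simp add: cmp_assoc_Arr triangle)
  finally show "((Id M a \<boxtimes> runit M b) \<cdot> tassoc M a b \<one>) \<boxtimes> Id M \<one> = runit M (a \<otimes> b) \<boxtimes> Id M \<one>"
    by (rule Iso_cancel_left [OF tassoc_iso, rotated -1]) (simp_all add: Hom_iff)
qed (simp_all add: Hom_iff)

end

section \<open>The left-tensored category of presheaves\<close>

lemma presheaves_simps [simp]:
  "Ob (presheaves M A) = {F. presheaf M A F}"
  "Arr (presheaves M A) = {\<phi>. presheaf_map M A \<phi>}"
  "Dom (presheaves M A) = psrc"
  "Cod (presheaves M A) = ptgt"
  "Id (presheaves M A) F = \<lparr>psrc = F, ptgt = F, pcomp = (\<lambda>x \<in> EOb A. Id M (pob F x))\<rparr>"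
  "\<psi> \<cdot>\<^bsub>presheaves M A\<^esub> \<phi> = \<lparr>psrc = psrc \<phi>, ptgt = ptgt \<psi>,
        pcomp = (\<lambda>x \<in> EOb A. pcomp \<psi> x \<cdot>\<^bsub>M\<^esub> pcomp \<phi> x)\<rparr>"
  "m \<odot>\<^bsub>presheaves M A\<^esub> F = presheaf_act M A m F"
  "g \<boxdot>\<^bsub>presheaves M A\<^esub> \<phi> = \<lparr>psrc = presheaf_act M A (Dom M g) (psrc \<phi>),
        ptgt = presheaf_act M A (Cod M g) (ptgt \<phi>),
        pcomp = (\<lambda>x \<in> EOb A. g \<boxtimes>\<^bsub>M\<^esub> pcomp \<phi> x)\<rparr>"
  "act_assoc (presheaves M A) m n F = \<lparr>psrc = presheaf_act M A (m \<otimes>\<^bsub>M\<^esub> n) F,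
        ptgt = presheaf_act M A m (presheaf_act M A n F),
        pcomp = (\<lambda>x \<in> EOb A. tassoc M m n (pob F x))\<rparr>"
  "act_unit (presheaves M A) F = \<lparr>psrc = presheaf_act M A \<one>\<^bsub>M\<^esub> F, ptgt = F,
        pcomp = (\<lambda>x \<in> EOb A. lunit M (pob F x))\<rparr>"
  by (simp_all add: presheaves_def)

lemma presheaf_act_simps [simp]:
  "x \<in> EOb A \<Longrightarrow> pob (presheaf_act M A m F) x = m \<otimes>\<^bsub>M\<^esub> pob F x"
  "\<lbrakk>x \<in> EOb A; y \<in> EOb A\<rbrakk> \<Longrightarrow> pstr (presheaf_act M A m F) x y
     = (Id M m \<boxtimes>\<^bsub>M\<^esub> pstr F x y) \<cdot>\<^bsub>M\<^esub> tassoc M m (pob F y) (hom A x y)"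
  by (simp_all add: presheaf_act_def)

context enriched_category
begin

section \<open>Tensoring a presheaf with an object of \<open>M\<close>\<close>

declare hom_closed [simp]

lemma eid_simps [simp]:
  assumes "x \<in> EOb A"
  shows "eid A x \<in> Arr M" "Dom M (eid A x) = \<one>" "Cod M (eid A x) = hom A x x"
  using eid_closed [OF assms] by (auto simp: Hom_iff)

lemma ecmp_simps [simp]:
  assumes "x \<in> EOb A" "y \<in> EOb A" "z \<in> EOb A"
  shows "ecmp A x y z \<in> Arr M" "Dom M (ecmp A x y z) = hom A y z \<otimes> hom A x y"
    "Cod M (ecmp A x y z) = hom A x z"
  using ecmp_closed [OF assms] by (auto simp: Hom_iff)

lemma pob_Ob [simp]: "\<lbrakk>presheaf M A F; x \<in> EOb A\<rbrakk> \<Longrightarrow> pob F x \<in> Ob M"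
  using presheaf.pob_closed [of M A F] by (auto simp: PiE_iff)

lemma pstr_simps [simp]:
  assumes "presheaf M A F" "x \<in> EOb A" "y \<in> EOb A"
  shows "pstr F x y \<in> Arr M" "Dom M (pstr F x y) = pob F y \<otimes> hom A x y"
    "Cod M (pstr F x y) = pob F x"
  using presheaf.pstr_closed [OF assms(1)] assms(2,3) by (auto simp: PiE_iff Hom_iff)

lemma pcomp_simps [simp]:
  assumes "presheaf_map M A \<phi>" "x \<in> EOb A"
  shows "pcomp \<phi> x \<in> Arr M" "Dom M (pcomp \<phi> x) = pob (psrc \<phi>) x"
    "Cod M (pcomp \<phi> x) = pob (ptgt \<phi>) x"
  using presheaf_map.pcomp_closed [OF assms(1)] assms(2) by (auto simp: PiE_iff Hom_iff)

lemma presheaf_map_presheaf [simp]: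
  assumes "presheaf_map M A \<phi>"
  shows "presheaf M A (psrc \<phi>)" "presheaf M A (ptgt \<phi>)"
  using assms by (auto simp only: presheaf_map_def)

lemma presheaf_act_presheaf [simp]:
  assumes m [simp]: "m \<in> Ob M" and F [simp]: "presheaf M A F"
  shows "presheaf M A (presheaf_act M A m F)"
proof
  show "pob (presheaf_act M A m F) \<in> EOb A \<rightarrow>\<^sub>E Ob M"
    by (auto simp: presheaf_act_def)
  show "pstr (presheaf_act M A m F) \<in> (\<Pi>\<^sub>E x \<in> EOb A. \<Pi>\<^sub>E y \<in> EOb A.
      Hom M (pob (presheaf_act M A m F) y \<otimes> hom A x y) (pob (presheaf_act M A m F) x))"
    by (auto simp: presheaf_act_def Hom_iff)
next
  fix x assume x [simp]: "x \<in> EOb A"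
  \<comment> \<open>\<open>tens_Id\<close> is switched off so that the identity of m \<otimes> F(x)
    stays split as a tensor, the shape that naturality of the associator needs.\<close>
  have "((Id M m \<boxtimes> pstr F x x) \<cdot> tassoc M m (pob F x) (hom A x x))
        \<cdot> ((Id M m \<boxtimes> Id M (pob F x)) \<boxtimes> eid A x)
      = (Id M m \<boxtimes> (pstr F x x \<cdot> (Id M (pob F x) \<boxtimes> eid A x))) \<cdot> tassoc M m (pob F x) \<one>"
    by (subst cmp_assoc_Arr, simp_all del: tens_Id)
      (simp add: tassoc_natural_Arr tens_cmp_cmp_Arr del: tens_Id)
  also have "\<dots> = runit M (m \<otimes> pob F x)"
    by (simp add: presheaf.pstr_eid [OF F] runit_tens)
  finally show "pstr (presheaf_act M A m F) x x
      \<cdot> (Id M (pob (presheaf_act M A m F) x) \<boxtimes> eid A x) = runit M (pob (presheaf_act M A m F) x)"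
    by simp
next
  fix x y z assume [simp]: "x \<in> EOb A" "y \<in> EOb A" "z \<in> EOb A"
  let ?X = "pob F x" and ?Y = "pob F y" and ?Z = "pob F z"
    and ?f = "hom A x y" and ?g = "hom A y z" and ?h = "hom A x z"
  let ?p = "tassoc M m (?Z \<otimes> ?g) ?f \<cdot> (tassoc M m ?Z ?g \<boxtimes> Id M ?f)"
  have "((Id M m \<boxtimes> pstr F x y) \<cdot> tassoc M m ?Y ?f)
        \<cdot> (((Id M m \<boxtimes> pstr F y z) \<cdot> tassoc M m ?Z ?g) \<boxtimes> Id M ?f)
      = (Id M m \<boxtimes> pstr F x y) \<cdot> ((tassoc M m ?Y ?f \<cdot> ((Id M m \<boxtimes> pstr F y z) \<boxtimes> Id M ?f))
        \<cdot> (tassoc M m ?Z ?g \<boxtimes> Id M ?f))"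
    by (simp add: cmp_assoc_Arr tens_cmp_Arr)
  also have "\<dots> = (Id M m \<boxtimes> (pstr F x y \<cdot> (pstr F y z \<boxtimes> Id M ?f))) \<cdot> ?p"
    by (simp add: tassoc_natural_Arr cmp_assoc_Arr tens_cmp_cmp_Arr)
  also have "\<dots> = (Id M m \<boxtimes> pstr F x z) \<cdot> ((Id M m \<boxtimes> (Id M ?Z \<boxtimes> ecmp A x y z))
        \<cdot> ((Id M m \<boxtimes> tassoc M ?Z ?g ?f) \<cdot> ?p))"
    by (simp add: presheaf.pstr_ecmp [OF F] tens_cmp_cmp_Arr cmp_assoc_Arr)
  \<comment> \<open>The pentagon at m, F(z), hom(y,z), hom(x,y) trades three associators for two;
    naturality then carries the composition of \<open>A\<close> across one of them.\<close>
  also have "\<dots> = (Id M m \<boxtimes> pstr F x z) \<cdot> (((Id M m \<boxtimes> (Id M ?Z \<boxtimes> ecmp A x y z))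
        \<cdot> tassoc M m ?Z (?g \<otimes> ?f)) \<cdot> tassoc M (m \<otimes> ?Z) ?g ?f)"
    by (simp add: pentagon cmp_assoc_Arr)
  also have "\<dots> = (Id M m \<boxtimes> pstr F x z) \<cdot> ((tassoc M m ?Z ?h
        \<cdot> ((Id M m \<boxtimes> Id M ?Z) \<boxtimes> ecmp A x y z)) \<cdot> tassoc M (m \<otimes> ?Z) ?g ?f)"
    by (subst tassoc_natural_Arr) simp_all
  finally show "pstr (presheaf_act M A m F) x y
        \<cdot> (pstr (presheaf_act M A m F) y z \<boxtimes> Id M (hom A x y))
      = pstr (presheaf_act M A m F) x z \<cdot> (Id M (pob (presheaf_act M A m F) z) \<boxtimes> ecmp A x y z)
        \<cdot> tassoc M (pob (presheaf_act M A m F) z) (hom A y z) (hom A x y)"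
    by (simp add: cmp_assoc_Arr)
qed

section \<open>Morphisms of presheaves and their constructions\<close>

lemma presheaf_mapI:
  assumes F: "presheaf M A F" and G: "presheaf M A G"
    and "\<And>x. x \<in> EOb A \<Longrightarrow> t x \<in> Hom M (pob F x) (pob G x)"
    and "\<And>x y. \<lbrakk>x \<in> EOb A; y \<in> EOb A\<rbrakk>
      \<Longrightarrow> pstr G x y \<cdot> (t y \<boxtimes> Id M (hom A x y)) = t x \<cdot> pstr F x y"
  shows "presheaf_map M A \<lparr>psrc = F, ptgt = G, pcomp = (\<lambda>x \<in> EOb A. t x)\<rparr>"
  using assms by (intro presheaf_map.intro presheaf_map_axioms.intro) auto

text \<open>Components are \<open>undefined\<close> off \<open>EOb A\<close>, so agreement on
  objects already gives equality of functions.\<close>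

lemma presheaf_map_eqI:
  assumes "presheaf_map M A \<phi>" "presheaf_map M A \<psi>" "psrc \<phi> = psrc \<psi>" "ptgt \<phi> = ptgt \<psi>"
    and "\<And>x. x \<in> EOb A \<Longrightarrow> pcomp \<phi> x = pcomp \<psi> x"
  shows "\<phi> = \<psi>"
proof -
  have "pcomp \<phi> = pcomp \<psi>"
    using presheaf_map.pcomp_closed [OF assms(1)] presheaf_map.pcomp_closed [OF assms(2)] assms(5)
    by (intro extensionalityI [of _ "EOb A"]) (auto simp: PiE_iff)
  then show ?thesis using assms(3,4)
    by (cases \<phi>, cases \<psi>) simp
qed

text \<open>Composing with an identity rebuilds the record from restricted components; this rule
  recognises the result as the original morphism.\<close>

lemma presheaf_map_collapse:
  assumes "presheaf_map M A \<phi>"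
  shows "\<lparr>psrc = psrc \<phi>, ptgt = ptgt \<phi>, pcomp = (\<lambda>x \<in> EOb A. pcomp \<phi> x)\<rparr> = \<phi>"
  using presheaf_map.pcomp_closed [OF assms]
  by (cases \<phi>) (simp add: PiE_iff extensional_restrict)

lemma presheaf_map_Id:
  "presheaf M A F \<Longrightarrow>
    presheaf_map M A \<lparr>psrc = F, ptgt = F, pcomp = (\<lambda>x \<in> EOb A. Id M (pob F x))\<rparr>"
  by (rule presheaf_mapI) (auto simp: Hom_iff)

text \<open>Two naturality squares are pasted along the shared presheaf
  \<open>ptgt \<phi>\<close>.\<close>

lemma presheaf_map_cmp:
  assumes \<phi> [simp]: "presheaf_map M A \<phi>" and \<psi> [simp]: "presheaf_map M A \<psi>"
    and eq: "psrc \<psi> = ptgt \<phi>"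
  shows "presheaf_map M A
    \<lparr>psrc = psrc \<phi>, ptgt = ptgt \<psi>, pcomp = (\<lambda>x \<in> EOb A. pcomp \<psi> x \<cdot> pcomp \<phi> x)\<rparr>"
proof (rule presheaf_mapI)
  fix x y assume [simp]: "x \<in> EOb A" "y \<in> EOb A"
  have "pstr (ptgt \<psi>) x y \<cdot> ((pcomp \<psi> y \<cdot> pcomp \<phi> y) \<boxtimes> Id M (hom A x y))
      = (pstr (ptgt \<psi>) x y \<cdot> (pcomp \<psi> y \<boxtimes> Id M (hom A x y))) \<cdot> (pcomp \<phi> y \<boxtimes> Id M (hom A x y))"
    by (simp add: cmp_assoc_Arr tens_cmp_Arr eq)
  also have "\<dots> = pcomp \<psi> x \<cdot> (pstr (ptgt \<phi>) x y \<cdot> (pcomp \<phi> y \<boxtimes> Id M (hom A x y)))"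
    by (simp add: presheaf_map.pcomp_natural [OF \<psi>] cmp_assoc_Arr eq)
  also have "\<dots> = (pcomp \<psi> x \<cdot> pcomp \<phi> x) \<cdot> pstr (psrc \<phi>) x y"
    by (simp add: presheaf_map.pcomp_natural [OF \<phi>] cmp_assoc_Arr eq)
  finally show "pstr (ptgt \<psi>) x y \<cdot> ((pcomp \<psi> y \<cdot> pcomp \<phi> y) \<boxtimes> Id M (hom A x y)) = \<dots>" .
qed (simp_all add: Hom_iff eq)

lemma presheaf_map_act:
  assumes g [simp]: "g \<in> Arr M" and \<phi> [simp]: "presheaf_map M A \<phi>"
  shows "presheaf_map M A \<lparr>psrc = presheaf_act M A (Dom M g) (psrc \<phi>),
    ptgt = presheaf_act M A (Cod M g) (ptgt \<phi>), pcomp = (\<lambda>x \<in> EOb A. g \<boxtimes> pcomp \<phi> x)\<rparr>"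
proof (rule presheaf_mapI)
  fix x y assume [simp]: "x \<in> EOb A" "y \<in> EOb A"
  show "pstr (presheaf_act M A (Cod M g) (ptgt \<phi>)) x y \<cdot> ((g \<boxtimes> pcomp \<phi> y) \<boxtimes> Id M (hom A x y))
      = (g \<boxtimes> pcomp \<phi> x) \<cdot> pstr (presheaf_act M A (Dom M g) (psrc \<phi>)) x y"
    by (simp add: cmp_assoc_Arr tassoc_natural_Arr tens_cmp_cmp_Arr
        presheaf_map.pcomp_natural [OF \<phi>])
qed (simp_all add: Hom_iff)

text \<open>Compatibility with the structure maps is the pentagon at m, n, F(y), hom(x,y), followed
  by naturality of the associator in its last argument.\<close>

lemma presheaf_map_act_assoc:
  assumes [simp]: "m \<in> Ob M" "n \<in> Ob M" and F [simp]: "presheaf M A F"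
  shows "presheaf_map M A \<lparr>psrc = presheaf_act M A (m \<otimes> n) F,
    ptgt = presheaf_act M A m (presheaf_act M A n F),
    pcomp = (\<lambda>x \<in> EOb A. tassoc M m n (pob F x))\<rparr>"
proof (rule presheaf_mapI)
  fix x y assume [simp]: "x \<in> EOb A" "y \<in> EOb A"
  let ?X = "pob F x" and ?Y = "pob F y" and ?f = "hom A x y"
  have "((Id M m \<boxtimes> ((Id M n \<boxtimes> pstr F x y) \<cdot> tassoc M n ?Y ?f)) \<cdot> tassoc M m (n \<otimes> ?Y) ?f)
        \<cdot> (tassoc M m n ?Y \<boxtimes> Id M ?f)
      = (Id M m \<boxtimes> (Id M n \<boxtimes> pstr F x y)) \<cdot> ((Id M m \<boxtimes> tassoc M n ?Y ?f)
        \<cdot> tassoc M m (n \<otimes> ?Y) ?f \<cdot> (tassoc M m n ?Y \<boxtimes> Id M ?f))"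
    by (simp add: cmp_assoc_Arr tens_cmp_cmp_Arr)
  also have "\<dots> = ((Id M m \<boxtimes> (Id M n \<boxtimes> pstr F x y)) \<cdot> tassoc M m n (?Y \<otimes> ?f))
      \<cdot> tassoc M (m \<otimes> n) ?Y ?f"
    by (simp add: pentagon [symmetric] cmp_assoc_Arr)
  also have "\<dots> = (tassoc M m n ?X \<cdot> ((Id M m \<boxtimes> Id M n) \<boxtimes> pstr F x y)) \<cdot> tassoc M (m \<otimes> n) ?Y ?f"
    by (subst tassoc_natural_Arr) simp_all
  finally show "pstr (presheaf_act M A m (presheaf_act M A n F)) x y \<cdot> (tassoc M m n ?Y \<boxtimes> Id M ?f)
      = tassoc M m n ?X \<cdot> pstr (presheaf_act M A (m \<otimes> n) F) x y"
    by (simp add: cmp_assoc_Arr)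
qed (simp_all add: Hom_iff)

lemma presheaf_map_act_unit:
  assumes F [simp]: "presheaf M A F"
  shows "presheaf_map M A \<lparr>psrc = presheaf_act M A \<one> F, ptgt = F,
    pcomp = (\<lambda>x \<in> EOb A. lunit M (pob F x))\<rparr>"
proof (rule presheaf_mapI)
  fix x y assume [simp]: "x \<in> EOb A" "y \<in> EOb A"
  let ?Y = "pob F y" and ?f = "hom A x y"
  have "pstr F x y \<cdot> (lunit M ?Y \<boxtimes> Id M ?f)
      = (pstr F x y \<cdot> lunit M (?Y \<otimes> ?f)) \<cdot> tassoc M \<one> ?Y ?f"
    by (simp add: lunit_tens [symmetric] cmp_assoc_Arr)
  also have "pstr F x y \<cdot> lunit M (?Y \<otimes> ?f) = lunit M (pob F x) \<cdot> (Id M \<one> \<boxtimes> pstr F x y)"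
    by (simp add: lunit_natural_Arr)
  finally show "pstr F x y \<cdot> (lunit M ?Y \<boxtimes> Id M ?f)
      = lunit M (pob F x) \<cdot> pstr (presheaf_act M A \<one> F) x y"
    by (simp add: cmp_assoc_Arr)
qed (simp_all add: Hom_iff)

section \<open>The category of presheaves and its module structure over \<open>M\<close>\<close>

lemma category_presheaves: "category (presheaves M A)"
proof
  show "(h \<cdot>\<^bsub>presheaves M A\<^esub> g) \<cdot>\<^bsub>presheaves M A\<^esub> f = h \<cdot>\<^bsub>presheaves M A\<^esub> (g \<cdot>\<^bsub>presheaves M A\<^esub> f)"
    if "f \<in> Hom (presheaves M A) a b" "g \<in> Hom (presheaves M A) b c"
      "h \<in> Hom (presheaves M A) c d" for f g h a b c d
    using that by (auto simp: Hom_iff cmp_assoc_Arr cong: restrict_cong)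
  show "Id (presheaves M A) b \<cdot>\<^bsub>presheaves M A\<^esub> f = f"
    if "f \<in> Hom (presheaves M A) a b" for f a b
    using that by (auto simp: Hom_iff presheaf_map_collapse cong: restrict_cong)
  show "f \<cdot>\<^bsub>presheaves M A\<^esub> Id (presheaves M A) a = f"
    if "f \<in> Hom (presheaves M A) a b" for f a b
    using that by (auto simp: Hom_iff presheaf_map_collapse cong: restrict_cong)
qed (auto simp: Hom_iff intro: presheaf_map_Id presheaf_map_cmp)

text \<open>Invertibility is detected objectwise because the inverses of the components are
  automatically compatible with the structure maps.\<close>

lemma presheaves_IsoI:
  assumes \<phi> [simp]: "presheaf_map M A \<phi>"
    and iso: "\<And>x. x \<in> EOb A \<Longrightarrow> pcomp \<phi> x \<in> Iso M (pob (psrc \<phi>) x) (pob (ptgt \<phi>) x)"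
  shows "\<phi> \<in> Iso (presheaves M A) (psrc \<phi>) (ptgt \<phi>)"
proof -
  have "\<exists>t. \<forall>x \<in> EOb A. t x \<in> Hom M (pob (ptgt \<phi>) x) (pob (psrc \<phi>) x)
      \<and> t x \<cdot> pcomp \<phi> x = Id M (pob (psrc \<phi>) x) \<and> pcomp \<phi> x \<cdot> t x = Id M (pob (ptgt \<phi>) x)"
    using iso unfolding Iso_iff by (intro bchoice) blast
  then obtain t where
    t [simp]: "\<And>x. x \<in> EOb A \<Longrightarrow> t x \<in> Arr M" "\<And>x. x \<in> EOb A \<Longrightarrow> Dom M (t x) = pob (ptgt \<phi>) x"
      "\<And>x. x \<in> EOb A \<Longrightarrow> Cod M (t x) = pob (psrc \<phi>) x"
    and inv: "\<And>x. x \<in> EOb A \<Longrightarrow> t x \<cdot> pcomp \<phi> x = Id M (pob (psrc \<phi>) x)"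
      "\<And>x. x \<in> EOb A \<Longrightarrow> pcomp \<phi> x \<cdot> t x = Id M (pob (ptgt \<phi>) x)"
    by (auto simp: Hom_iff)
  let ?\<psi> = "\<lparr>psrc = ptgt \<phi>, ptgt = psrc \<phi>, pcomp = (\<lambda>x \<in> EOb A. t x)\<rparr>"
  have "presheaf_map M A ?\<psi>"
  proof (rule presheaf_mapI)
    fix x y assume [simp]: "x \<in> EOb A" "y \<in> EOb A"
    let ?f = "Id M (hom A x y)"
    \<comment> \<open>Insert \<open>t x \<cdot> pcomp \<phi> x\<close>, use naturality of
      \<open>\<phi>\<close> to move the component across the structure map, and cancel
      \<open>pcomp \<phi> y\<close> against \<open>t y\<close>.\<close>
    have "pstr (psrc \<phi>) x y \<cdot> (t y \<boxtimes> ?f)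
        = (t x \<cdot> pcomp \<phi> x) \<cdot> (pstr (psrc \<phi>) x y \<cdot> (t y \<boxtimes> ?f))"
      by (simp add: inv)
    also have "\<dots> = t x \<cdot> ((pcomp \<phi> x \<cdot> pstr (psrc \<phi>) x y) \<cdot> (t y \<boxtimes> ?f))"
      by (simp add: cmp_assoc_Arr)
    also have "\<dots> = t x \<cdot> ((pstr (ptgt \<phi>) x y \<cdot> (pcomp \<phi> y \<boxtimes> ?f)) \<cdot> (t y \<boxtimes> ?f))"
      by (simp add: presheaf_map.pcomp_natural [OF \<phi>])
    also have "\<dots> = t x \<cdot> pstr (ptgt \<phi>) x y"
      by (simp add: cmp_assoc_Arr tens_cmp_Arr inv)
    finally show "pstr (psrc \<phi>) x y \<cdot> (t y \<boxtimes> ?f) = t x \<cdot> pstr (ptgt \<phi>) x y" .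
  qed (simp_all add: Hom_iff)
  then show ?thesis
    unfolding Iso_iff by (intro conjI bexI [of _ ?\<psi>]) (auto simp: Hom_iff inv cong: restrict_cong)
qed

text \<open>Naturality and coherence of the constraints are inherited componentwise from
  \<open>M\<close>. The constraints are isomorphisms because they are presheaf morphisms with
  invertible components.\<close>

lemma left_tensored_presheaves: "left_tensored_category M (presheaves M A)"
proof -
  interpret B: category "presheaves M A" by (rule category_presheaves)
  show ?thesis
  proof
    show "act_assoc (presheaves M A) m n b \<in> Iso (presheaves M A)
        ((m \<otimes> n) \<odot>\<^bsub>presheaves M A\<^esub> b) (m \<odot>\<^bsub>presheaves M A\<^esub> (n \<odot>\<^bsub>presheaves M A\<^esub> b))"
      if "m \<in> Ob M" "n \<in> Ob M" "b \<in> Ob (presheaves M A)" for m n b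
      using presheaves_IsoI [OF presheaf_map_act_assoc [of m n b]] that by (simp add: tassoc_iso)
    show "act_unit (presheaves M A) b \<in> Iso (presheaves M A) (\<one> \<odot>\<^bsub>presheaves M A\<^esub> b) b"
      if "b \<in> Ob (presheaves M A)" for b
      using presheaves_IsoI [OF presheaf_map_act_unit [of b]] that by (simp add: lunit_iso)
  qed (auto simp: Hom_iff tens_cmp_Arr tassoc_natural_Arr lunit_natural_Arr
      pentagon triangle presheaf_map_act cong: restrict_cong)
qed

end

section \<open>The Yoneda embedding\<close>

lemma yoneda_ob_simps [simp]:
  "x \<in> EOb A \<Longrightarrow> pob (yoneda_ob A z) x = hom A x z"
  "\<lbrakk>x \<in> EOb A; y \<in> EOb A\<rbrakk> \<Longrightarrow> pstr (yoneda_ob A z) x y = ecmp A x y z"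
  by (simp_all add: yoneda_ob_def)

lemma yoneda_simps [simp]:
  "fob (yoneda M A) = yoneda_ob A"
  "fstr (yoneda M A) x y = \<lparr>psrc = presheaf_act M A (hom A x y) (yoneda_ob A x),
     ptgt = yoneda_ob A y, pcomp = (\<lambda>z \<in> EOb A. ecmp A z x y)\<rparr>"
  by (simp_all add: yoneda_def)

context enriched_category
begin

text \<open>The presheaf laws of Y(z) are associativity and the right unit law of
  \<open>A\<close>.\<close>

lemma presheaf_yoneda_ob [simp]:
  assumes [simp]: "z \<in> EOb A"
  shows "presheaf M A (yoneda_ob A z)"
proof
  show "pob (yoneda_ob A z) \<in> EOb A \<rightarrow>\<^sub>E Ob M"
    by (auto simp: yoneda_ob_def)
  show "pstr (yoneda_ob A z) \<in> (\<Pi>\<^sub>E x \<in> EOb A. \<Pi>\<^sub>E y \<in> EOb A.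
      Hom M (pob (yoneda_ob A z) y \<otimes> hom A x y) (pob (yoneda_ob A z) x))"
    by (auto simp: yoneda_ob_def Hom_iff)
qed (simp_all add: ecmp_assoc ecmp_eid_right)

text \<open>Associativity of \<open>A\<close> again, now read as naturality in the object at which
  the presheaves are evaluated.\<close>

lemma presheaf_map_yoneda_fstr:
  assumes [simp]: "x \<in> EOb A" "y \<in> EOb A"
  shows "presheaf_map M A (fstr (yoneda M A) x y)"
  unfolding yoneda_simps
  by (rule presheaf_mapI) (simp_all add: Hom_iff ecmp_assoc cmp_assoc_Arr)

text \<open>At each object the action law is associativity of \<open>A\<close> and the unit law is
  its left unit law, since the associator and unit constraint of presheaves are those of
  \<open>M\<close>.\<close>

lemma enriched_functor_yoneda: "enriched_functor M A (presheaves M A) (yoneda M A)"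
proof -
  interpret left_tensored_category M "presheaves M A" by (rule left_tensored_presheaves)
  show ?thesis
    by unfold_locales
      (use presheaf_map_yoneda_fstr in
        \<open>auto simp: Hom_iff ecmp_assoc ecmp_eid_left cong: restrict_cong\<close>)
qed

lemma yoneda_represents:
  assumes [simp]: "x \<in> EOb A" "y \<in> EOb A" "m \<in> Ob M"
  shows "bij_betw (\<lambda>g. fstr (yoneda M A) x y \<cdot>\<^bsub>presheaves M A\<^esub>
        (g \<boxdot>\<^bsub>presheaves M A\<^esub> Id (presheaves M A) (fob (yoneda M A) x)))
      (Hom M m (hom A x y))
      (Hom (presheaves M A) (m \<odot>\<^bsub>presheaves M A\<^esub> fob (yoneda M A) x) (fob (yoneda M A) y))"
    (is "bij_betw ?\<Phi> ?S ?T")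
proof (rule bij_betw_imageI)
  interpret f: enriched_functor M A "presheaves M A" "yoneda M A"
    by (rule enriched_functor_yoneda)
  have \<Phi>: "?\<Phi> g \<in> ?T" if "g \<in> ?S" for g
    by (rule f.B.cmp_closed
        [OF f.act_arr_closed [OF that f.B.Id_closed [OF f.fob_closed]] f.fstr_closed]) simp_all
  have pcomp_\<Phi>: "pcomp (?\<Phi> g) z = ecmp A z x y \<cdot> (g \<boxtimes> Id M (hom A z x))"
    if "g \<in> ?S" "z \<in> EOb A" for g z
    using that by (simp add: Hom_iff)
  \<comment> \<open>Evaluation at the identity of \<open>x\<close> returns \<open>g\<close> up to
    the invertible \<open>runit M m\<close>: interchange slides \<open>g\<close> past
    \<open>eid A x\<close>, then the right unit law of \<open>A\<close> and naturality of
    \<open>runit\<close> apply. Injectivity follows.\<close>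
  have evaluate: "pcomp (?\<Phi> g) x \<cdot> (Id M m \<boxtimes> eid A x) = g \<cdot> runit M m" if g: "g \<in> ?S" for g
  proof -
    have [simp]: "g \<in> Arr M" "Dom M g = m" "Cod M g = hom A x y" using g by (auto simp: Hom_iff)
    have "pcomp (?\<Phi> g) x \<cdot> (Id M m \<boxtimes> eid A x)
        = (ecmp A x x y \<cdot> (Id M (hom A x y) \<boxtimes> eid A x)) \<cdot> (g \<boxtimes> Id M \<one>)"
      unfolding pcomp_\<Phi> [OF g \<open>x \<in> EOb A\<close>] by (simp add: cmp_assoc_Arr tens_cmp_Arr)
    also have "\<dots> = runit M (hom A x y) \<cdot> (g \<boxtimes> Id M \<one>)"
      by (simp add: ecmp_eid_right)
    also have "\<dots> = g \<cdot> runit M m"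
      by (rule runit_natural [OF g])
    finally show ?thesis .
  qed
  show "inj_on ?\<Phi> ?S"
  proof (rule inj_onI)
    fix g h assume g: "g \<in> ?S" and h: "h \<in> ?S" and eq: "?\<Phi> g = ?\<Phi> h"
    have "g \<cdot> runit M m = h \<cdot> runit M m"
      using evaluate [OF g] evaluate [OF h] unfolding eq by simp
    then show "g = h" by (rule Iso_cancel_right [OF runit_iso g h, rotated]) simp
  qed
  have "\<exists>g \<in> ?S. ?\<Phi> g = \<phi>" if \<phi>: "\<phi> \<in> ?T" for \<phi>
  proof -
    have [simp]: "presheaf_map M A \<phi>" and src [simp]: "psrc \<phi> = presheaf_act M A m (yoneda_ob A x)"
      and tgt [simp]: "ptgt \<phi> = yoneda_ob A y"
      using \<phi> by (auto simp: Hom_iff)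
    obtain r where r [simp]: "r \<in> Arr M" "Dom M r = m" "Cod M r = m \<otimes> \<one>"
      and r_inv: "r \<cdot> runit M m = Id M (m \<otimes> \<one>)" "runit M m \<cdot> r = Id M m"
      using runit_iso [of m] by (auto simp: Iso_iff Hom_iff)
    \<comment> \<open>By \<open>evaluate\<close> this is the only possible preimage of
      \<open>\<phi>\<close>; \<open>r\<close> is the inverse of \<open>runit M m\<close>.\<close>
    define g where "g = pcomp \<phi> x \<cdot> (Id M m \<boxtimes> eid A x) \<cdot> r"
    have g: "g \<in> ?S" by (simp add: g_def Hom_iff)
    have "?\<Phi> g = \<phi>"
    proof (rule presheaf_map_eqI)
      show "presheaf_map M A (?\<Phi> g)" "psrc (?\<Phi> g) = psrc \<phi>" "ptgt (?\<Phi> g) = ptgt \<phi>"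
        using \<Phi> [OF g] by (simp_all only: Hom_iff presheaves_simps mem_Collect_eq src tgt
            yoneda_simps)
      fix z assume z [simp]: "z \<in> EOb A"
      let ?h = "hom A z x"
      \<comment> \<open>Reading \<open>ecmp A z x y\<close> as the structure map of Y(y) puts it
        next to \<open>pcomp \<phi> x\<close>, so that naturality of \<open>\<phi>\<close> moves the
        evaluation from \<open>x\<close> to \<open>z\<close>.\<close>
      have "pcomp (?\<Phi> g) z = (pstr (ptgt \<phi>) z x \<cdot> (pcomp \<phi> x \<boxtimes> Id M ?h))
          \<cdot> (((Id M m \<boxtimes> eid A x) \<boxtimes> Id M ?h) \<cdot> (r \<boxtimes> Id M ?h))"
        unfolding pcomp_\<Phi> [OF g z] by (simp add: g_def cmp_assoc_Arr tens_cmp_Arr)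
      also have "\<dots> = (pcomp \<phi> z \<cdot> ((Id M m \<boxtimes> ecmp A z x x) \<cdot> tassoc M m (hom A x x) ?h))
          \<cdot> (((Id M m \<boxtimes> eid A x) \<boxtimes> Id M ?h) \<cdot> (r \<boxtimes> Id M ?h))"
        by (subst presheaf_map.pcomp_natural [of M A \<phi>]) simp_all
      also have "\<dots> = pcomp \<phi> z \<cdot> (Id M m \<boxtimes> ecmp A z x x)
          \<cdot> (tassoc M m (hom A x x) ?h \<cdot> ((Id M m \<boxtimes> eid A x) \<boxtimes> Id M ?h)) \<cdot> (r \<boxtimes> Id M ?h)"
        by (simp add: cmp_assoc_Arr)
      \<comment> \<open>Naturality of the associator brings \<open>eid A x\<close> directly before
        the composition, where the left unit law of \<open>A\<close> absorbs it.\<close>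
      also have "\<dots> = pcomp \<phi> z \<cdot> (Id M m \<boxtimes> (ecmp A z x x \<cdot> (eid A x \<boxtimes> Id M ?h)))
          \<cdot> tassoc M m \<one> ?h \<cdot> (r \<boxtimes> Id M ?h)"
        by (simp add: tassoc_natural_Arr cmp_assoc_Arr tens_cmp_cmp_Arr)
      also have "\<dots> = pcomp \<phi> z \<cdot> ((Id M m \<boxtimes> lunit M ?h) \<cdot> tassoc M m \<one> ?h) \<cdot> (r \<boxtimes> Id M ?h)"
        by (simp add: ecmp_eid_left cmp_assoc_Arr)
      \<comment> \<open>The triangle turns the bracket into
        \<open>runit M m \<boxtimes> Id M ?h\<close>, which cancels against
        \<open>r \<boxtimes> Id M ?h\<close>.\<close>
      also have "\<dots> = pcomp \<phi> z"
        by (simp add: triangle tens_cmp_Arr r_inv)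
      finally show "pcomp (?\<Phi> g) z = pcomp \<phi> z" .
    qed simp
    with g show ?thesis by blast
  qed
  with \<Phi> show "?\<Phi> ` ?S = ?T" by (auto simp only: image_iff)
qed

lemma fully_faithful_functor_yoneda:
  "fully_faithful_functor M A (presheaves M A) (yoneda M A)"
  by (intro fully_faithful_functor.intro enriched_functor_yoneda
      fully_faithful_functor_axioms.intro yoneda_represents)

end

theorem theorem3p3p5:
  fixes M :: "('o, 'm) monoidal_category"
    and A :: "('a, 'o, 'm) enriched_category"
  assumes "monoidal_category M"
    and "enriched_category M A"
  shows "enriched_functor M A (presheaves M A) (yoneda M A)
       \<and> fully_faithful_functor M A (presheaves M A) (yoneda M A)"
  using enriched_category.enriched_functor_yoneda [OF assms(2)]
    enriched_category.fully_faithful_functor_yoneda [OF assms(2)] by blast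

end
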